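(* There is an absolute constant $C>0$ such that for all integers $1\leq r\leq n$, setting $x=x_r(n/r)$, one has \[ P\big(\ell_r(\bar Z)=n\big)=\frac{Q(x)}{\sqrt{2\pi\lambda(x)}}\,(1+\varepsilon_{n,r}),\qquad |\varepsilon_{n,r}|\leq \frac{Cr}{n}. \]
   Context: $Z_1,Z_2,\dots$ are independent Poisson random variables with $\mathbf{E}Z_j=1/j$, and $\ell_r(\bar Z)=1Z_1+2Z_2+\cdots+rZ_r$. For an integer $r\geq1$ and real $u\geq 1$, $x_r(u)$ denotes the unique positive solution of $\sum_{j=1}^r x_r(u)^j=ur$. For given $n,r$ and $z>0$, \[ Q(z)=\frac{1}{z^n}\exp\left\{\sum_{j=1}^r\frac{z^j-1}{j}\right\},\qquad \lambda(z)=\sum_{j=1}^r jz^j . \] *)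

theory Defs
  imports "HOL-Probability.Probability"
begin

text \<open>
  Only the variables with index at least 1 are constrained; the value of \<open>Z\<close> at index 0 is
  irrelevant.
\<close>
definition indep_poisson_harmonic :: "'a measure \<Rightarrow> (nat \<Rightarrow> 'a \<Rightarrow> nat) \<Rightarrow> bool" where
  "indep_poisson_harmonic M Z \<longleftrightarrow>
     prob_space M \<and>
     prob_space.indep_vars M (\<lambda>_. count_space UNIV) Z {1..} \<and>
     (\<forall>j\<ge>1. distr M (count_space UNIV) (Z j) = measure_pmf (poisson_pmf (1 / real j)))"

definition ell :: "nat \<Rightarrow> (nat \<Rightarrow> 'a \<Rightarrow> nat) \<Rightarrow> 'a \<Rightarrow> nat" where
  "ell r Z \<omega> = (\<Sum>j=1..r. j * Z j \<omega>)"

definition saddle :: "nat \<Rightarrow> real \<Rightarrow> real" where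
  "saddle r u = (THE x. 0 < x \<and> (\<Sum>j=1..r. x ^ j) = u * real r)"

definition Qfun :: "nat \<Rightarrow> nat \<Rightarrow> real \<Rightarrow> real" where
  "Qfun n r z = 1 / z ^ n * exp (\<Sum>j=1..r. (z ^ j - 1) / real j)"

definition lam :: "nat \<Rightarrow> real \<Rightarrow> real" where
  "lam r z = (\<Sum>j=1..r. real j * z ^ j)"

text \<open>The definite description in the definition of \<open>saddle\<close> is well defined.\<close>
lemma saddle_unique:
  assumes r: "1 \<le> r" and u: "1 \<le> u"
  shows "\<exists>!x::real. 0 < x \<and> (\<Sum>j=1..r. x ^ j) = u * real r"
proof -
  define f where "f x = (\<Sum>j=1..r. x ^ j)" for x :: real
  have mono: "f x < f y" if "0 \<le> x" "x < y" for x y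
    unfolding f_def using r that by (intro sum_strict_mono power_strict_mono) auto
  have "\<exists>x\<ge>0. x \<le> u * r \<and> f x = u * r"
  proof (rule IVT')
    show "f 0 \<le> u * r" using r u by (simp add: f_def power_0_left)
    have "(u * r) ^ 1 \<le> f (u * r)"
      unfolding f_def using r u by (intro member_le_sum) auto
    then show "u * r \<le> f (u * r)" by simp
    show "0 \<le> u * r" using u by simp
    show "continuous_on {0..u * r} f" unfolding f_def by (intro continuous_intros)
  qed
  then obtain x where x: "0 \<le> x" "f x = u * r" by auto
  have "f 0 = 0" by (simp add: f_def power_0_left)
  then have "x > 0" using x r u by (cases "x = 0") auto
  moreover have "y = x" if "0 < y" "f y = u * r" for y
    using mono[of x y] mono[of y x] that x by (cases x y rule: linorder_cases) auto
  ultimately show ?thesis using x(2) unfolding f_def by blast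
qed

end

theory Submission
  imports Defs
begin

text \<open>
  Let \<open>x\<close> be the saddle point, \<open>u = n / r\<close>, and let \<open>A\<close> and \<open>B\<close> denote \<open>damping\<close> and \<open>phase\<close>, so
  that \<open>exp (- A t + \<ii> B t)\<close> is the centred characteristic function of the exponentially tilted
  sum. Fourier inversion gives \<open>pi P(ell = n) = Q(x) \<integral>\<^sub>0\<^sup>\<pi> exp (- A) cos B\<close>. On \<open>[0, 1/r]\<close> one has
  \<open>A = \<lambda> t\<^sup>2 / 2 + O(r\<^sup>2 \<lambda> t\<^sup>4)\<close> and \<open>B = O(r \<lambda> t\<^sup>3)\<close>, so the integrand is a Gaussian with relative
  error \<open>O(r\<^sup>2 / \<lambda>)\<close>, and \<open>r n / 2 \<le> \<lambda> \<le> r n\<close>. On \<open>[1/r, pi]\<close> one integrates by parts once and uses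
  that \<open>A\<close> is bounded below by a multiple of both the fourth root of \<open>u\<close> and \<open>ln (r t)\<close>.
\<close>

section \<open>Elementary estimates for cosine and sine\<close>

lemma one_minus_cos_le: "1 - cos s \<le> s\<^sup>2 / 2" for s :: real
proof -
  obtain t where t: "cos s = (\<Sum>m<2. cos_coeff m * s ^ m) + cos (t + 1/2 * real 2 * pi) / fact 2 * s ^ 2"
    using Maclaurin_cos_expansion[of s 2] by blast
  have "cos (t + pi) * s\<^sup>2 \<ge> (-1) * s\<^sup>2"
    by (intro mult_right_mono) (auto simp del: cos_periodic_pi)
  then show ?thesis using t by (simp add: eval_nat_numeral cos_coeff_def)
qed

lemma one_minus_cos_ge: "s\<^sup>2 / 2 - s ^ 4 / 24 \<le> 1 - cos s" for s :: real
proof -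
  obtain t where t: "cos s = (\<Sum>m<4. cos_coeff m * s ^ m) + cos (t + 1/2 * real 4 * pi) / fact 4 * s ^ 4"
    using Maclaurin_cos_expansion[of s 4] by blast
  have "cos (t + 2 * pi) * s ^ 4 \<le> 1 * s ^ 4"
    by (intro mult_right_mono) (auto simp del: cos_periodic)
  moreover have "(\<Sum>m<4. cos_coeff m * s ^ m) = 1 - s\<^sup>2 / 2"
  proof -
    have "cos_coeff 3 = 0" by (simp add: cos_coeff_def)
    then show ?thesis by (simp add: eval_nat_numeral) (simp add: cos_coeff_def)
  qed
  ultimately show ?thesis using t by (simp add: fact_numeral)
qed

lemma abs_sin_minus_le: "\<bar>sin s - s\<bar> \<le> \<bar>s\<bar> ^ 3 / 6" for s :: real
  using Maclaurin_sin_bound[of s 3] by (simp add: eval_nat_numeral sin_coeff_def)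

text \<open>The cosine decreases on \<open>[0, pi]\<close>, so \<open>s = 1/4\<close> is the worst
  case; there the quartic bound gives 1/32 - 1/6144 > 1/40.\<close>

lemma one_minus_cos_ge_quarter:
  assumes "1/4 \<le> s" "s \<le> pi"
  shows "1/40 \<le> 1 - cos s"
proof -
  have "cos s \<le> cos (1/4)"
    using assms by (intro cos_monotone_0_pi_le) auto
  moreover have "1/40 \<le> 1 - cos (1/4 :: real)"
    using one_minus_cos_ge[of "1/4"] by (simp add: eval_nat_numeral)
  ultimately show ?thesis by simp
qed

text \<open>Up to 1 the quartic term is absorbed by the quadratic one. Beyond 1 monotonicity keeps
  \<open>1 - cos t\<close> above 11/24, while \<open>t\<^sup>2 / 40\<close> stays below
  16/40.\<close>

lemma one_minus_cos_ge_square: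
  assumes "0 \<le> t" "t \<le> pi"
  shows "t\<^sup>2 / 40 \<le> 1 - cos t"
proof (cases "t \<le> 1")
  case True
  then have "t ^ 4 \<le> t\<^sup>2" using assms by (intro power_decreasing) auto
  with one_minus_cos_ge[of t] show ?thesis using zero_le_power2[of t] by linarith
next
  case False
  have "cos t \<le> cos 1"
    using assms False by (intro cos_monotone_0_pi_le) auto
  moreover have "11/24 \<le> 1 - cos (1 :: real)"
    using one_minus_cos_ge[of 1] by simp
  moreover have "t\<^sup>2 \<le> 4\<^sup>2"
    using assms pi_less_4 by (intro power_mono) auto
  ultimately show ?thesis by simp
qed

section \<open>Lower bounds for cosine sums\<close>

lemma power2_sum_le: "(p + q)\<^sup>2 \<le> 2 * (p\<^sup>2 + q\<^sup>2)" for p q :: real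
  using sum_squares_bound[of p q] by (simp add: power2_sum)

text \<open>Since \<open>1 - cos y\<close> is twice the square of \<open>sin (y / 2)\<close>, this
  follows from |sin (p - q)| <= |sin p| + |sin q|.\<close>

lemma one_minus_cos_diff_le: "1 - cos (b - a) \<le> 2 * ((1 - cos a) + (1 - cos b))" for a b :: real
proof -
  have *: "1 - cos y = 2 * (sin (y / 2))\<^sup>2" for y :: real
    using cos_double_sin[of "y/2"] by simp
  have "\<bar>sin ((b - a) / 2)\<bar> \<le> \<bar>sin (b / 2) * cos (a / 2)\<bar> + \<bar>cos (b / 2) * sin (a / 2)\<bar>"
    unfolding diff_divide_distrib sin_diff by (rule abs_triangle_ineq4)
  also have "\<dots> \<le> \<bar>sin (b / 2)\<bar> * 1 + 1 * \<bar>sin (a / 2)\<bar>"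
    unfolding abs_mult by (intro add_mono mult_left_mono mult_right_mono) auto
  finally have "\<bar>sin ((b - a) / 2)\<bar>\<^sup>2 \<le> (\<bar>sin (b / 2)\<bar> + \<bar>sin (a / 2)\<bar>)\<^sup>2"
    by (intro power_mono) auto
  also have "\<dots> \<le> 2 * (\<bar>sin (b / 2)\<bar>\<^sup>2 + \<bar>sin (a / 2)\<bar>\<^sup>2)"
    by (rule power2_sum_le)
  finally show ?thesis by (simp add: *)
qed

text \<open>The block \<open>(r/4, r]\<close> contains many pairs \<open>j, j + d\<close> with \<open>d t\<close> bounded away from
  \<open>2 pi \<int>\<close>; the two members of such a pair cannot both have \<open>cos (j t)\<close> close to 1.\<close>
lemma one_minus_cos_block_ge:
  fixes r :: nat
  assumes r: "1 \<le> r" and t: "1 / real r \<le> t" "t \<le> pi"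
  shows "1/1280 \<le> (\<Sum>j\<in>{r div 4<..r}. (1 - cos (real j * t)) / real j)"
proof -
  let ?J = "{r div 4<..r}"
  let ?S = "\<Sum>j\<in>?J. 1 - cos (real j * t)"
  have r0: "real r > 0" using r by simp
  have t0: "t > 0" using t r0 by (meson divide_pos_pos less_le_trans zero_less_one)
  have div4: "real (r div 4) \<le> real r / 4" by simp
  \<comment> \<open>An unweighted bound; on the block \<open>1 / j\<close> is at least
    \<open>1 / r\<close>, which turns it into the claim.\<close>
  have S: "real r / 1280 \<le> ?S"
  proof (cases "real r * t \<le> pi")
    case True
    \<comment> \<open>All angles \<open>j * t\<close> lie in \<open>[1/4, pi]\<close> here, so every
      single term is at least 1/40.\<close>
    have "real (card ?J) * (1/40) \<le> ?S"
    proof (rule sum_bounded_below)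
      fix j assume j: "j \<in> ?J"
      then have "real j \<ge> real r / 4" by (simp add: div_less_iff_less_mult)
      then have "real r / 4 * t \<le> real j * t" using t0 by (intro mult_right_mono) auto
      moreover have "1 \<le> real r * t" using t r0 by (simp add: field_simps)
      moreover have "real j * t \<le> real r * t" using j t0 by (intro mult_right_mono) auto
      ultimately show "1/40 \<le> 1 - cos (real j * t)"
        using True by (intro one_minus_cos_ge_quarter) auto
    qed
    moreover have "real (card ?J) = real r - real (r div 4)"
      by (simp add: of_nat_diff)
    ultimately show ?thesis using div4 r0 by linarith
  next
    case False
    then have r2: "r \<ge> 2" using t r by (cases "r = 1") auto
    \<comment> \<open>The least integer with \<open>d * t \<ge> 1/4\<close>. The angle
      \<open>d * t\<close> does not exceed \<open>pi\<close>: either \<open>d = 1\<close>, or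
      \<open>t < 1/4\<close> and \<open>d * t < 1/2\<close>.\<close>
    define d where "d = nat \<lceil>1 / (4 * t)\<rceil>"
    have pos: "1 / (4 * t) > 0" using t0 by simp
    then have d1: "d \<ge> 1" unfolding d_def by linarith
    have d_ge: "1 / (4 * t) \<le> real d" unfolding d_def by linarith
    have d_less: "real d < 1 / (4 * t) + 1" unfolding d_def using pos by linarith
    have dt: "1/4 \<le> real d * t" using d_ge t0 by (simp add: field_simps)
    have "real d * t \<le> pi"
    proof (cases "d = 1")
      case True then show ?thesis using t by simp
    next
      case False
      then have "1 < 1 / (4 * t)" using d1 d_less by linarith
      then have "t < 1/4" using t0 by (simp add: field_simps)
      moreover have "real d * t < (1 / (4 * t) + 1) * t" using d_less t0 by (intro mult_strict_right_mono)
      moreover have "(1 / (4 * t) + 1) * t = 1/4 + t" using t0 by (simp add: field_simps)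
      ultimately show ?thesis using pi_gt3 by linarith
    qed
    with dt have dcos: "1/40 \<le> 1 - cos (real d * t)" by (rule one_minus_cos_ge_quarter)
    have "1 / (4 * t) \<le> real r / 12"
    proof -
      have "3 < real r * t" using False pi_gt3 by linarith
      then show ?thesis using t0 by (simp add: field_simps)
    qed
    then have d_up: "real d \<le> real r / 12 + 1" using d_less by linarith
    let ?K = "{r div 4<..r - d}"
    have "d \<le> r" using d_up r2 by linarith
    \<comment> \<open>The cardinality is at least \<open>r - (r/12 + 1) - r/4\<close>. As
      \<open>r \<ge> 2\<close>, this is at least \<open>r / 6\<close>, and the pairs then give
      \<open>?S \<ge> r / 960\<close>.\<close>
    have cardK: "real (card ?K) \<ge> real r * 2 / 3 - 1"
      using d_up div4 \<open>d \<le> r\<close> by (simp add: of_nat_diff)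
    have "real (card ?K) * (1/80) \<le> (\<Sum>j\<in>?K. (1 - cos (real j * t)) + (1 - cos (real (j + d) * t)))"
    proof (rule sum_bounded_below)
      fix j
      show "1/80 \<le> (1 - cos (real j * t)) + (1 - cos (real (j + d) * t))"
        using one_minus_cos_diff_le[of "real (j + d) * t" "real j * t"] dcos
        by (simp add: algebra_simps)
    qed
    also have "\<dots> = (\<Sum>j\<in>?K. 1 - cos (real j * t)) + (\<Sum>j\<in>(\<lambda>j. j + d) ` ?K. 1 - cos (real j * t))"
      unfolding sum.distrib by (subst sum.reindex) (auto simp: inj_on_def)
    \<comment> \<open>Both \<open>?K\<close> and its shift by \<open>d\<close> lie in the block, so
      each index is counted at most twice.\<close>
    also have "\<dots> \<le> ?S + ?S"
      using \<open>d \<le> r\<close> by (intro add_mono sum_mono2) auto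
    finally have "real (card ?K) / 80 \<le> 2 * ?S" by simp
    then show ?thesis using cardK r2 by linarith
  qed
  have "1/1280 = (1 / real r) * (real r / 1280)" using r0 by simp
  also have "\<dots> \<le> (1 / real r) * ?S" using S r0 by (intro mult_left_mono) auto
  also have "\<dots> \<le> (\<Sum>j\<in>?J. (1 - cos (real j * t)) / real j)"
    unfolding sum_distrib_left
    using divide_left_mono[of _ "real r" "1 - cos _"] by (intro sum_mono) auto
  finally show ?thesis .
qed

text \<open>Induction from \<open>r div 4\<close> to \<open>r\<close>: when
  \<open>r * t \<ge> 1\<close>, the block above \<open>r div 4\<close> adds 1/1280 = 5/6400, while
  the logarithm grows by at most ln 8 < 4. The ratio 8 in place of 4 allows for rounding in
  \<open>r div 4\<close>. For \<open>r < 4\<close> one block suffices, because ln 12 < 5.\<close>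

lemma one_minus_cos_sum_ge_ln:
  fixes r :: nat
  assumes "1 \<le> r" "0 < t" "t \<le> pi"
  shows "ln (real r * t) / 6400 \<le> (\<Sum>j=1..r. (1 - cos (real j * t)) / real j)"
  using assms(1)
proof (induction r rule: less_induct)
  case (less r)
  let ?f = "\<lambda>j. (1 - cos (real j * t)) / real j"
  have r0: "real r > 0" using less.prems by simp
  show ?case
  proof (cases "real r * t < 1")
    case True
    then have "ln (real r * t) \<le> 0" using r0 assms by simp
    moreover have "0 \<le> (\<Sum>j=1..r. ?f j)" by (intro sum_nonneg) auto
    ultimately show ?thesis by linarith
  next
    case False
    then have t: "1 / real r \<le> t" using r0 by (simp add: field_simps)
    have split: "(\<Sum>j=1..r. ?f j) = (\<Sum>j=1..r div 4. ?f j) + (\<Sum>j\<in>{r div 4<..r}. ?f j)"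
      by (subst sum.union_disjoint[symmetric]) (auto intro!: sum.cong)
    have block: "1/1280 \<le> (\<Sum>j\<in>{r div 4<..r}. ?f j)"
      by (rule one_minus_cos_block_ge[OF less.prems t assms(3)])
    have ln8: "ln (8 * y) \<le> 4 + ln y" if "y > 0" for y :: real
    proof -
      have "exp (4::real) = exp 1 ^ 4" by (simp flip: exp_of_nat_mult)
      moreover have "(2::real) ^ 4 \<le> exp 1 ^ 4"
        using exp_ge_add_one_self[of 1] by (intro power_mono) auto
      ultimately have "8 \<le> exp (4::real)" by simp
      then have "ln 8 \<le> (4::real)" by (metis ln_exp ln_le_cancel_iff exp_gt_zero zero_less_numeral)
      then show ?thesis using that by (simp add: ln_mult)
    qed
    show ?thesis
    proof (cases "r < 4")
      case True
      then have "real r * t \<le> 3 * 4"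
        using assms pi_less_4 by (intro mult_mono) auto
      then have "ln (real r * t) \<le> ln (8 * (3/2))" using r0 assms by simp
      also have "\<dots> \<le> 4 + ln (3/2)" by (rule ln8) simp
      also have "\<dots> \<le> 5" using ln_le_minus_one[of "3/2 :: real"] by simp
      finally show ?thesis using True block split by simp
    next
      case False
      have "ln (real (r div 4) * t) / 6400 \<le> (\<Sum>j=1..r div 4. ?f j)"
        using False by (intro less.IH) auto
      moreover have "ln (real r * t) \<le> ln (8 * (real (r div 4) * t))"
      proof -
        have "r \<le> 8 * (r div 4)" using False by presburger
        then have "real r \<le> 8 * real (r div 4)" by linarith
        then show ?thesis using r0 assms
          by (subst ln_le_cancel_iff) (auto intro!: mult_right_mono mult_pos_pos simp: mult.assoc[symmetric])
      qed
      moreover have "\<dots> \<le> 4 + ln (real (r div 4) * t)"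
        using False assms by (intro ln8 mult_pos_pos) auto
      ultimately show ?thesis using block split by simp
    qed
  qed
qed

section \<open>Modulus and argument of the tilted characteristic function\<close>

definition damping :: "nat \<Rightarrow> real \<Rightarrow> real \<Rightarrow> real" where
  "damping r x t = (\<Sum>j=1..r. x ^ j * (1 - cos (real j * t)) / real j)"

text \<open>Tilting by \<open>x\<close> makes \<open>Z j\<close> Poisson with mean
  \<open>x ^ j / j\<close>. Subtracting \<open>real j * t\<close> centres the tilted sum at its mean
  \<open>\<Sum>j=1..r. x ^ j\<close>, which is \<open>n\<close> at the saddle point.\<close>

definition phase :: "nat \<Rightarrow> real \<Rightarrow> real \<Rightarrow> real" where
  "phase r x t = (\<Sum>j=1..r. x ^ j * (sin (real j * t) - real j * t) / real j)"

lemma continuous_on_damping [continuous_intros]: "continuous_on S (damping r x)"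
  unfolding damping_def [abs_def] by (intro continuous_intros) auto

lemma continuous_on_phase [continuous_intros]: "continuous_on S (phase r x)"
  unfolding phase_def [abs_def] by (intro continuous_intros) auto

text \<open>In the closed form \<open>w * (w ^ r - 1) / (w - 1)\<close> the numerator is at most
  \<open>2 * x ^ (r + 1)\<close> in norm, and \<open>norm (w - 1) \<ge> x * t / 10\<close>. The
  resulting \<open>1 / t\<close> is the decay that the tail estimate exploits.\<close>

lemma norm_geometric_cis_sum_le:
  assumes x: "1 \<le> x" and t: "0 < t" "t \<le> pi"
  shows "norm (\<Sum>j=1..r. (of_real x * cis t) ^ j) \<le> 20 * x ^ r / t"
proof -
  define w where "w = of_real x * cis t"
  have nw: "norm w = x" using x by (simp add: w_def norm_mult)
  have "(norm (w - 1))\<^sup>2 = (x * cos t - 1)\<^sup>2 + (x * sin t)\<^sup>2"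
    by (simp add: w_def cmod_power2)
  also have "\<dots> = (x - 1)\<^sup>2 + 2 * x * (1 - cos t)"
    using sin_cos_squared_add[of t] by algebra
  also have "\<dots> \<ge> x\<^sup>2 * (1 - cos t) / 2"
  proof -
    \<comment> \<open>Splitting \<open>(x - 1)\<^sup>2\<close> with weights
      \<open>(1 + cos t) / 2\<close> and \<open>(1 - cos t) / 2\<close> exhibits the difference as a
      sum of nonnegative terms.\<close>
    have "(x - 1)\<^sup>2 + 2 * x * (1 - cos t) - x\<^sup>2 * (1 - cos t) / 2
       = (x - 1)\<^sup>2 * (1 + cos t) / 2 + (2 * x + 1) * (1 - cos t) / 2"
      by (simp add: power2_eq_square field_simps)
    also have "\<dots> \<ge> 0"
      using x cos_ge_minus_one[of t] cos_le_one[of t]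
      by (intro add_nonneg_nonneg[of "_ / 2"] divide_nonneg_nonneg mult_nonneg_nonneg zero_le_power2) linarith+
    finally show ?thesis by simp
  qed
  also have "x\<^sup>2 * (1 - cos t) / 2 \<ge> x\<^sup>2 * (t\<^sup>2 / 40) / 2"
    using one_minus_cos_ge_square[of t] t by (intro divide_right_mono mult_left_mono) auto
  finally have *: "x\<^sup>2 * (t\<^sup>2 / 40) / 2 \<le> (norm (w - 1))\<^sup>2" .
  have "0 \<le> x\<^sup>2 * t\<^sup>2" by (intro mult_nonneg_nonneg zero_le_power2)
  moreover have "(x * t / 10)\<^sup>2 = x\<^sup>2 * t\<^sup>2 / 100"
    by (simp add: power_mult_distrib power_divide)
  ultimately have "(x * t / 10)\<^sup>2 \<le> (norm (w - 1))\<^sup>2" using * by linarith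
  then have low: "x * t / 10 \<le> norm (w - 1)"
    by (rule power2_le_imp_le) simp
  have xt: "0 < x * t / 10" using x t by simp
  then have "w \<noteq> 1" using low by auto
  moreover have "(\<Sum>j=1..r. w ^ j) * (w - 1) = w * (w ^ r - 1)"
    by (induction r) (simp_all add: algebra_simps)
  ultimately have "(\<Sum>j=1..r. w ^ j) = w * (w ^ r - 1) / (w - 1)"
    by (simp add: eq_divide_eq)
  then have "norm (\<Sum>j=1..r. w ^ j) = x * norm (w ^ r - 1) / norm (w - 1)"
    by (simp add: norm_mult norm_divide nw)
  also have "\<dots> \<le> x * (2 * x ^ r) / (x * t / 10)"
  proof (intro frac_le mult_left_mono)
    have "norm (w ^ r - 1) \<le> x ^ r + 1"
      using norm_triangle_ineq4[of "w ^ r" 1] by (simp add: norm_power nw)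
    also have "\<dots> \<le> 2 * x ^ r" using one_le_power[OF x, of r] by simp
    finally show "norm (w ^ r - 1) \<le> 2 * x ^ r" .
  qed (use x xt low in auto)
  also have "\<dots> = 20 * x ^ r / t" using x t by simp
  finally show ?thesis by (simp add: w_def)
qed

section \<open>The saddle point and the size of \<open>lam\<close>\<close>

locale saddle_point =
  fixes n r :: nat and x :: real
  assumes r_pos: "1 \<le> r" and r_le_n: "r \<le> n" and x_pos: "0 < x"
    and saddle_eq: "(\<Sum>j=1..r. x ^ j) = real n"
begin

definition u :: real where "u = real n / real r"

lemma u_ge_1: "1 \<le> u" and n_eq: "real n = u * real r"
  using r_pos r_le_n by (simp_all add: u_def)

lemma x_ge_1: "1 \<le> x"
proof (rule ccontr)
  assume "\<not> 1 \<le> x"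
  then have "(\<Sum>j=1..r. x ^ j) < (\<Sum>j=1..r. 1)"
    using r_pos x_pos by (intro sum_strict_mono) (auto simp: power_less_one_iff)
  then show False using saddle_eq r_le_n by simp
qed

lemma sum_reflect: "(\<Sum>j=1..r. f j) = (\<Sum>j=1..r. f (r + 1 - j))" for f :: "nat \<Rightarrow> real"
  using sum.atLeastAtMost_rev[of f 1 r] by simp

lemma lam_le: "lam r x \<le> real r * real n"
  unfolding lam_def saddle_eq[symmetric] sum_distrib_left
  using x_pos by (intro sum_mono mult_right_mono) auto

text \<open>Chebyshev's sum inequality: as \<open>x \<ge> 1\<close>, the factors
  \<open>2 * j - (r + 1)\<close> and \<open>x ^ j - x ^ (r + 1 - j)\<close> have the same sign.
  Summing their products and reflecting the index gives
  \<open>(r + 1) * n \<le> 2 * lam r x\<close>.\<close>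

lemma lam_ge: "real r * real n / 2 \<le> lam r x"
proof -
  have "0 \<le> (\<Sum>j=1..r. (2 * real j - (real r + 1)) * (x ^ j - x ^ (r + 1 - j)))"
  proof (rule sum_nonneg)
    fix j assume j: "j \<in> {1..r}"
    show "0 \<le> (2 * real j - (real r + 1)) * (x ^ j - x ^ (r + 1 - j))"
    proof (cases "2 * j \<le> r + 1")
      case True
      then have "x ^ j \<le> x ^ (r + 1 - j)" using x_ge_1 by (intro power_increasing) auto
      then show ?thesis using True by (intro mult_nonpos_nonpos) auto
    next
      case False
      then have "x ^ (r + 1 - j) \<le> x ^ j" using x_ge_1 by (intro power_increasing) auto
      then show ?thesis using False by (intro mult_nonneg_nonneg) auto
    qed
  qed
  also have "\<dots> = (\<Sum>j=1..r. (2 * real j - (real r + 1)) * x ^ j)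
      - (\<Sum>j=1..r. (2 * real j - (real r + 1)) * x ^ (r + 1 - j))"
    by (simp add: right_diff_distrib sum_subtractf)
  also have "(\<Sum>j=1..r. (2 * real j - (real r + 1)) * x ^ (r + 1 - j))
     = (\<Sum>j=1..r. - ((2 * real j - (real r + 1)) * x ^ j))"
    by (subst sum_reflect, rule sum.cong) (auto simp: of_nat_diff algebra_simps)
  also have "(\<Sum>j=1..r. (2 * real j - (real r + 1)) * x ^ j) - \<dots>
     = 2 * (2 * lam r x - (real r + 1) * real n)"
    unfolding lam_def saddle_eq[symmetric] sum_distrib_left sum_negf
    by (simp add: algebra_simps sum_subtractf sum.distrib sum_distrib_left)
  finally have "(real r + 1) * real n \<le> 2 * lam r x" by (simp only: zero_le_mult_iff) simp
  then show ?thesis by (simp add: algebra_simps)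
qed

lemma lam_pos: "0 < lam r x"
proof -
  have "0 < real r * real n / 2" using r_pos r_le_n by simp
  then show ?thesis using lam_ge by linarith
qed

text \<open>By AM-GM the terms of index \<open>j\<close> and \<open>r + 1 - j\<close> add up to at
  least \<open>2 * sqrt x ^ (r + 1)\<close>; averaging over \<open>j\<close> gives
  \<open>sqrt x ^ (r + 1) \<le> u\<close>.\<close>

lemma power_r_le: "x ^ r \<le> u\<^sup>2"
proof -
  define y where "y = sqrt x"
  have y: "0 < y" "y\<^sup>2 = x" using x_pos by (auto simp: y_def)
  have "(\<Sum>j=1..r. 2 * y ^ (r + 1)) \<le> (\<Sum>j=1..r. x ^ j + x ^ (r + 1 - j))"
  proof (rule sum_mono)
    fix j assume j: "j \<in> {1..r}"
    have "y ^ (r + 1) = y ^ j * y ^ (r + 1 - j)" using j by (simp flip: power_add)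
    moreover have "x ^ i = (y ^ i)\<^sup>2" for i by (simp add: y(2)[symmetric] power_mult[symmetric] mult.commute)
    ultimately show "2 * y ^ (r + 1) \<le> x ^ j + x ^ (r + 1 - j)"
      using sum_squares_bound[of "y ^ j" "y ^ (r + 1 - j)"] by simp
  qed
  also have "\<dots> = 2 * (u * real r)"
    using sum_reflect[of "\<lambda>j. x ^ j"] saddle_eq n_eq by (simp add: sum.distrib)
  finally have "y ^ (r + 1) \<le> u" using r_pos by (simp add: field_simps)
  then have "(y ^ (r + 1))\<^sup>2 \<le> u\<^sup>2" using y by (intro power_mono) auto
  moreover have "(y ^ (r + 1))\<^sup>2 = x ^ (r + 1)"
    by (simp only: y(2)[symmetric] power_mult[symmetric] mult.commute)
  moreover have "x ^ r \<le> x ^ (r + 1)" using x_ge_1 by (intro power_increasing) auto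
  ultimately show ?thesis by linarith
qed

text \<open>The largest term \<open>x ^ r\<close> is at least the average \<open>u\<close>, and
  \<open>(x ^ j) ^ 4 \<ge> x ^ r\<close> because \<open>4 * j \<ge> r\<close>.\<close>

lemma power_ge:
  assumes "r \<le> 4 * j"
  shows "sqrt (sqrt u) \<le> x ^ j"
proof -
  have "real n \<le> (\<Sum>j=1..r. x ^ r)"
    unfolding saddle_eq[symmetric] using x_ge_1 by (intro sum_mono power_increasing) auto
  then have "u \<le> x ^ r" using n_eq r_pos by (simp add: mult.commute)
  also have "\<dots> \<le> x ^ (4 * j)" using x_ge_1 assms by (intro power_increasing) auto
  also have "\<dots> = ((x ^ j)\<^sup>2)\<^sup>2" by (simp add: power_mult[symmetric] mult.commute)
  finally have "sqrt u \<le> (x ^ j)\<^sup>2" by (simp add: real_le_lsqrt x_pos less_imp_le)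
  then show ?thesis by (simp add: real_le_lsqrt x_pos less_imp_le)
qed

section \<open>Bounds for damping and phase\<close>

text \<open>On the block \<open>(r/4, r]\<close> every weight \<open>x ^ j\<close> is at least the
  fourth root of \<open>u\<close>; the other terms are nonnegative.\<close>

lemma damping_ge_quartic_root:
  assumes t: "1 / real r \<le> t" "t \<le> pi"
  shows "sqrt (sqrt u) / 1280 \<le> damping r x t"
proof -
  have "sqrt (sqrt u) * (1/1280) \<le> sqrt (sqrt u) * (\<Sum>j\<in>{r div 4<..r}. (1 - cos (real j * t)) / real j)"
    using u_ge_1 by (intro mult_left_mono one_minus_cos_block_ge r_pos t) auto
  also have "\<dots> \<le> (\<Sum>j\<in>{r div 4<..r}. x ^ j * ((1 - cos (real j * t)) / real j))"
    unfolding sum_distrib_left by (intro sum_mono mult_right_mono power_ge) auto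
  also have "\<dots> \<le> (\<Sum>j=1..r. x ^ j * ((1 - cos (real j * t)) / real j))"
    using x_pos by (intro sum_mono2) auto
  finally show ?thesis by (simp add: damping_def)
qed

lemma damping_ge_ln:
  assumes t: "0 < t" "t \<le> pi"
  shows "ln (real r * t) / 6400 \<le> damping r x t"
proof -
  have "(\<Sum>j=1..r. 1 * ((1 - cos (real j * t)) / real j)) \<le> (\<Sum>j=1..r. x ^ j * ((1 - cos (real j * t)) / real j))"
    using x_ge_1 by (intro sum_mono mult_right_mono one_le_power) auto
  then show ?thesis
    using one_minus_cos_sum_ge_ln[OF r_pos t] by (simp add: damping_def)
qed

text \<open>Both lower bounds are needed: the first makes the tail negligible when \<open>u\<close> is large,
  the second provides integrability in \<open>t\<close> when \<open>u\<close> is bounded.\<close>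
lemma exp_damping_le:
  assumes t: "1 / real r \<le> t" "t \<le> pi"
  shows "exp (- damping r x t) \<le> exp (- sqrt (sqrt u) / 2560) * (real r * t) powr (- 1 / 12800)"
proof -
  have r0: "0 < real r" using r_pos by simp
  have t0: "0 < t" using t r0 by (meson divide_pos_pos less_le_trans zero_less_one)
  \<comment> \<open>Half of each lower bound is used, which doubles the constants 1280 and
    6400.\<close>
  have "- damping r x t \<le> - sqrt (sqrt u) / 2560 - ln (real r * t) / 12800"
    using damping_ge_quartic_root[OF t] damping_ge_ln[OF t0 t(2)] by linarith
  then have "exp (- damping r x t) \<le> exp (- sqrt (sqrt u) / 2560 - ln (real r * t) / 12800)"
    by simp
  also have "\<dots> = exp (- sqrt (sqrt u) / 2560) * (real r * t) powr (- 1 / 12800)"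
    using r0 t0 by (simp add: powr_def flip: exp_add)
  finally show ?thesis .
qed

lemma damping_le: "damping r x t \<le> lam r x * t\<^sup>2 / 2"
proof -
  have "x ^ j * (1 - cos (real j * t)) / real j \<le> real j * x ^ j * (t\<^sup>2 / 2)" if j: "j \<in> {1..r}" for j
  proof -
    have "x ^ j * (1 - cos (real j * t)) / real j \<le> x ^ j * ((real j * t)\<^sup>2 / 2) / real j"
      using x_pos by (intro divide_right_mono mult_left_mono one_minus_cos_le) auto
    also have "\<dots> = real j * x ^ j * (t\<^sup>2 / 2)" using j by (simp add: power2_eq_square)
    finally show ?thesis .
  qed
  then have "damping r x t \<le> (\<Sum>j=1..r. real j * x ^ j * (t\<^sup>2 / 2))"
    unfolding damping_def by (intro sum_mono)
  then show ?thesis by (simp add: lam_def sum_distrib_right flip: sum_divide_distrib)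
qed

text \<open>The quartic Taylor term of index \<open>j\<close> carries \<open>j ^ 3 * x ^ j\<close>.
  Bounding two of the factors \<open>j\<close> by \<open>r\<close> leaves \<open>j * x ^ j\<close>,
  which sums to \<open>lam r x\<close>; for the phase one factor is bounded in this way.\<close>

lemma damping_ge: "lam r x * t\<^sup>2 / 2 - (real r)\<^sup>2 * lam r x * t ^ 4 / 24 \<le> damping r x t"
proof -
  have "real j * x ^ j * (t\<^sup>2 / 2) - (real r)\<^sup>2 * (real j * x ^ j) * (t ^ 4 / 24)
      \<le> x ^ j * (1 - cos (real j * t)) / real j" if j: "j \<in> {1..r}" for j
  proof -
    have "(real j)\<^sup>2 * (real j * x ^ j) * (t ^ 4 / 24) \<le> (real r)\<^sup>2 * (real j * x ^ j) * (t ^ 4 / 24)"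
      using x_pos j by (intro mult_right_mono power_mono) auto
    then have "real j * x ^ j * (t\<^sup>2 / 2) - (real r)\<^sup>2 * (real j * x ^ j) * (t ^ 4 / 24)
       \<le> real j * x ^ j * (t\<^sup>2 / 2) - (real j)\<^sup>2 * (real j * x ^ j) * (t ^ 4 / 24)" by linarith
    also have "\<dots> = x ^ j * ((real j * t)\<^sup>2 / 2 - (real j * t) ^ 4 / 24) / real j"
      using j by (simp add: power2_eq_square power4_eq_xxxx field_simps)
    also have "\<dots> \<le> x ^ j * (1 - cos (real j * t)) / real j"
      using x_pos by (intro divide_right_mono mult_left_mono one_minus_cos_ge) auto
    finally show ?thesis .
  qed
  then have "(\<Sum>j=1..r. real j * x ^ j * (t\<^sup>2 / 2) - (real r)\<^sup>2 * (real j * x ^ j) * (t ^ 4 / 24)) \<le> damping r x t"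
    unfolding damping_def by (intro sum_mono)
  moreover have "(\<Sum>j=1..r. real j * x ^ j * (t\<^sup>2 / 2) - (real r)\<^sup>2 * (real j * x ^ j) * (t ^ 4 / 24))
     = lam r x * (t\<^sup>2 / 2) - (real r)\<^sup>2 * lam r x * (t ^ 4 / 24)"
    by (simp only: lam_def sum_subtractf sum_distrib_left sum_distrib_right)
  ultimately show ?thesis by simp
qed

lemma abs_phase_le:
  assumes "0 \<le> t"
  shows "\<bar>phase r x t\<bar> \<le> real r * lam r x * t ^ 3 / 6"
proof -
  have "\<bar>x ^ j * (sin (real j * t) - real j * t) / real j\<bar> \<le> real r * (real j * x ^ j) * (t ^ 3 / 6)"
    if j: "j \<in> {1..r}" for j
  proof -
    have "\<bar>x ^ j * (sin (real j * t) - real j * t) / real j\<bar> \<le> x ^ j * ((real j * t) ^ 3 / 6) / real j"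
      unfolding abs_mult abs_divide using x_pos abs_sin_minus_le[of "real j * t"] assms
      by (intro frac_le mult_mono) (use j in auto)
    also have "\<dots> = real j * (real j * x ^ j) * (t ^ 3 / 6)"
      using j by (simp add: power3_eq_cube field_simps)
    also have "\<dots> \<le> real r * (real j * x ^ j) * (t ^ 3 / 6)"
      using x_pos j assms by (intro mult_right_mono) auto
    finally show ?thesis .
  qed
  then have "\<bar>phase r x t\<bar> \<le> (\<Sum>j=1..r. real r * (real j * x ^ j) * (t ^ 3 / 6))"
    unfolding phase_def by (rule order.trans[OF sum_abs sum_mono])
  also have "\<dots> = real r * lam r x * (t ^ 3 / 6)"
    by (simp only: lam_def sum_distrib_left sum_distrib_right)
  finally show ?thesis by simp
qed

text \<open>For \<open>r * t \<le> 1\<close> the quartic error is at most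
  \<open>lam r x * t\<^sup>2 / 24\<close>, and 1/2 - 1/24 > 1/4.\<close>

lemma damping_ge_inner:
  assumes "0 \<le> t" "t \<le> 1 / real r"
  shows "lam r x * t\<^sup>2 / 4 \<le> damping r x t"
proof -
  have "(real r)\<^sup>2 * lam r x * t ^ 4 = lam r x * t\<^sup>2 * (real r * t)\<^sup>2"
    by (simp add: power2_eq_square power4_eq_xxxx)
  also have "\<dots> \<le> lam r x * t\<^sup>2 * 1\<^sup>2"
    using assms lam_pos r_pos by (intro mult_left_mono power_mono) (auto simp: field_simps)
  finally have "(real r)\<^sup>2 * lam r x * t ^ 4 \<le> lam r x * t\<^sup>2" by simp
  moreover have "0 \<le> lam r x * t\<^sup>2" using lam_pos by simp
  ultimately show ?thesis using damping_ge[of t] by linarith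
qed

end

section \<open>The central Gaussian integral\<close>

text \<open>Raise \<open>s \<le> exp s\<close> with \<open>s = y / (c * k)\<close> to the power
  \<open>k\<close>. This lets part of an exponential decay absorb a power of
  \<open>y\<close>.\<close>

lemma power_times_exp_le:
  fixes y c :: real
  assumes "0 \<le> y" "0 < c" "0 < k"
  shows "y ^ k * exp (- y / c) \<le> (c * real k) ^ k"
proof -
  have "y / (c * real k) \<le> exp (y / (c * real k))"
    using exp_ge_add_one_self[of "y / (c * real k)"] by linarith
  then have "(y / (c * real k)) ^ k \<le> exp (y / (c * real k)) ^ k"
    using assms by (intro power_mono) auto
  also have "\<dots> = exp (y / c)" using assms by (simp flip: exp_of_nat_mult)
  finally have "y ^ k \<le> (c * real k) ^ k * exp (y / c)"
    using assms by (simp add: power_divide field_simps)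
  then show ?thesis by (simp add: exp_minus field_simps)
qed

lemma has_bochner_integral_gaussian_half_line:
  assumes a: "0 < a"
  shows "has_bochner_integral lborel (\<lambda>t. indicator {0..} t * exp (- a * t\<^sup>2)) (sqrt (pi / a) / 2)"
proof -
  have "has_bochner_integral lborel (\<lambda>t. indicator {0..} (0 + sqrt a * t) *\<^sub>R exp (- (0 + sqrt a * t)\<^sup>2))
      ((sqrt pi / 2) /\<^sub>R \<bar>sqrt a\<bar>)"
    using gaussian_moment_0 a by (subst (asm) lborel_has_bochner_integral_real_affine_iff[of "sqrt a" _ _ 0]) auto
  moreover have "indicator {0..} (0 + sqrt a * t) = (indicator {0..} t :: real)" for t
    using a by (auto simp: indicator_def zero_le_mult_iff)
  moreover have "(0 + sqrt a * t)\<^sup>2 = a * t\<^sup>2" for t using a by (simp add: power_mult_distrib)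
  ultimately show ?thesis using a by (simp add: real_sqrt_divide field_simps)
qed

context saddle_point
begin

text \<open>Put \<open>y = lam r x * t\<^sup>2\<close> and \<open>R = r\<^sup>2 / lam r x\<close>.
  Replacing the cosine by 1 costs half the squared phase, at most \<open>R * y ^ 3 / 72\<close>;
  replacing the damping by \<open>y / 2\<close> costs \<open>R * y\<^sup>2 / 24\<close>. Of the
  decay \<open>exp (- y / 4)\<close>, one half absorbs the powers of \<open>y\<close> and the other
  remains for integration.\<close>

lemma inner_gaussian_approx:
  assumes t: "0 \<le> t" "t \<le> 1 / real r"
  shows "\<bar>exp (- damping r x t) * cos (phase r x t) - exp (- (lam r x / 2) * t\<^sup>2)\<bar>
    \<le> 256 * ((real r)\<^sup>2 / lam r x) * exp (- (lam r x / 8) * t\<^sup>2)"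
proof -
  define y where "y = lam r x * t\<^sup>2"
  define R where "R = (real r)\<^sup>2 / lam r x"
  define A where "A = damping r x t"
  have R: "0 \<le> R" and y: "0 \<le> y" using lam_pos by (auto simp: R_def y_def)
  have R_lam: "R * lam r x = (real r)\<^sup>2" using lam_pos by (simp add: R_def)
  have A: "y / 4 \<le> A" "A \<le> y / 2"
    using damping_ge_inner[OF t] damping_le[of t] by (simp_all add: y_def A_def)
  have eA: "exp (- A) \<le> exp (- y / 8) * exp (- y / 8)"
    using A by (simp flip: exp_add)
  \<comment> \<open>The constants are 16^2 and 24^3. They lead to 24^3 / 72 = 192 and 256 / 24 < 11,
    whose sum is below 256.\<close>
  have y2: "y ^ 2 * exp (- y / 8) \<le> 256" and y3: "y ^ 3 * exp (- y / 8) \<le> 13824"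
    using power_times_exp_le[OF y, of 8 2] power_times_exp_le[OF y, of 8 3] by simp_all
  have B: "\<bar>exp (- A) * cos (phase r x t) - exp (- A)\<bar> \<le> R * 192 * exp (- y / 8)"
  proof -
    have "(phase r x t)\<^sup>2 \<le> (real r * lam r x * t ^ 3 / 6)\<^sup>2"
      using abs_phase_le[OF t(1)] by (subst power2_abs[symmetric]) (intro power_mono; simp)
    also have "\<dots> = R * y ^ 3 / 36"
      by (simp add: y_def power_mult_distrib power_divide R_lam[symmetric] flip: power_mult)
        (simp add: power2_eq_square power3_eq_cube)
    finally have ph: "(phase r x t)\<^sup>2 / 2 \<le> R * y ^ 3 / 72" by simp
    have "\<bar>exp (- A) * cos (phase r x t) - exp (- A)\<bar> = exp (- A) * (1 - cos (phase r x t))"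
      by (subst abs_minus_commute, subst abs_of_nonneg) (auto simp: algebra_simps)
    also have "\<dots> \<le> exp (- A) * (R * y ^ 3 / 72)"
      using one_minus_cos_le[of "phase r x t"] ph by (intro mult_left_mono) auto
    also have "\<dots> \<le> (exp (- y / 8) * exp (- y / 8)) * (R * y ^ 3 / 72)"
      using eA R y by (intro mult_right_mono) auto
    also have "\<dots> = (y ^ 3 * exp (- y / 8)) * (R * exp (- y / 8) / 72)" by simp
    also have "\<dots> \<le> 13824 * (R * exp (- y / 8) / 72)"
      using y3 R by (intro mult_right_mono) auto
    finally show ?thesis by simp
  qed
  have C: "\<bar>exp (- A) - exp (- y / 2)\<bar> \<le> R * 11 * exp (- y / 8)"
  proof -
    have "y / 2 - A \<le> R * y\<^sup>2 / 24"
    proof -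
      have "R * y\<^sup>2 = (real r)\<^sup>2 * lam r x * t ^ 4"
        by (simp add: y_def power_mult_distrib R_lam[symmetric] flip: power_mult) (simp add: power2_eq_square)
      then show ?thesis using damping_ge[of t] by (simp add: y_def A_def)
    qed
    have "exp (- A) * (1 + (A - y / 2)) \<le> exp (- A) * exp (A - y / 2)"
      by (intro mult_left_mono exp_ge_add_one_self) auto
    also have "\<dots> = exp (- y / 2)" by (simp flip: exp_add)
    finally have "exp (- A) - exp (- y / 2) \<le> exp (- A) * (y / 2 - A)" by (simp add: algebra_simps)
    also have "\<dots> \<le> (exp (- y / 8) * exp (- y / 8)) * (R * y\<^sup>2 / 24)"
      using eA A \<open>y / 2 - A \<le> R * y\<^sup>2 / 24\<close> by (intro mult_mono) auto
    also have "\<dots> = (y ^ 2 * exp (- y / 8)) * (R * exp (- y / 8) / 24)" by simp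
    also have "\<dots> \<le> 256 * (R * exp (- y / 8) / 24)"
      using y2 R by (intro mult_right_mono) auto
    also have "\<dots> \<le> R * 11 * exp (- y / 8)" using R by simp
    finally have "exp (- A) - exp (- y / 2) \<le> R * 11 * exp (- y / 8)" .
    moreover have "exp (- y / 2) \<le> exp (- A)" using A by simp
    ultimately show ?thesis by simp
  qed
  have "0 \<le> R * exp (- y / 8)" using R by simp
  then have "\<bar>exp (- A) * cos (phase r x t) - exp (- y / 2)\<bar> \<le> 256 * R * exp (- y / 8)"
    using B C by linarith
  then show ?thesis by (simp add: y_def A_def R_def mult.commute mult.left_commute)
qed

text \<open>Beyond \<open>1 / r\<close> one has \<open>R * y = (r * t)\<^sup>2 \<ge> 1\<close>, so
  the factor \<open>R\<close> can be inserted at no cost. The majorant agrees with that of the inner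
  range, so a single Gaussian dominates on the whole half line.\<close>

lemma gaussian_tail_le:
  assumes t: "1 / real r < t"
  shows "exp (- (lam r x / 2) * t\<^sup>2) \<le> 256 * ((real r)\<^sup>2 / lam r x) * exp (- (lam r x / 8) * t\<^sup>2)"
proof -
  define y where "y = lam r x * t\<^sup>2"
  define R where "R = (real r)\<^sup>2 / lam r x"
  have R: "0 \<le> R" and y: "0 \<le> y" using lam_pos by (auto simp: R_def y_def)
  have "1 \<le> real r * t" using t r_pos by (simp add: field_simps)
  then have "1\<^sup>2 \<le> (real r * t)\<^sup>2" by (intro power_mono) auto
  also have "\<dots> = R * y" using lam_pos by (simp add: R_def y_def power_mult_distrib)
  finally have Ry: "1 \<le> R * y" by simp
  have "1 * exp (- y / 2) \<le> (R * y) * exp (- y / 2)" using Ry by (intro mult_right_mono) auto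
  also have "\<dots> \<le> (R * y) * (exp (- y / 8) * exp (- y / 8))"
    using R y by (intro mult_left_mono) (auto simp flip: exp_add)
  also have "\<dots> = (y ^ 1 * exp (- y / 8)) * (R * exp (- y / 8))" by simp
  also have "\<dots> \<le> 256 * (R * exp (- y / 8))"
    using power_times_exp_le[OF y, of 8 1] R by (intro mult_right_mono) auto
  finally show ?thesis by (simp add: y_def R_def mult.commute mult.left_commute)
qed

text \<open>The main term is the Gaussian integral over the full half line; the cut-off integrand
  differs from that Gaussian by at most the common majorant.\<close>

lemma inner_integral:
  "\<bar>integral {0..1 / real r} (\<lambda>t. exp (- damping r x t) * cos (phase r x t)) - sqrt (2 * pi / lam r x) / 2\<bar>
    \<le> 256 * ((real r)\<^sup>2 / lam r x) * sqrt (8 * pi / lam r x)"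
proof -
  define F where "F = (\<lambda>t. exp (- damping r x t) * cos (phase r x t))"
  let ?G = "\<lambda>a t. indicator {0..} t * exp (- a * t\<^sup>2) :: real"
  let ?c = "256 * ((real r)\<^sup>2 / lam r x)"
  have int_F: "set_integrable lborel {0..1 / real r} F"
    unfolding F_def by (intro borel_integrable_atLeastAtMost' continuous_intros)
  have half: "has_bochner_integral lborel (?G (lam r x / 2)) (sqrt (2 * pi / lam r x) / 2)"
    using has_bochner_integral_gaussian_half_line[of "lam r x / 2"] lam_pos by (simp add: mult.commute)
  have eighth: "has_bochner_integral lborel (?G (lam r x / 8)) (sqrt (8 * pi / lam r x) / 2)"
    using has_bochner_integral_gaussian_half_line[of "lam r x / 8"] lam_pos by (simp add: mult.commute)
  have diff: "integral {0..1 / real r} F - sqrt (2 * pi / lam r x) / 2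
      = (\<integral>t. indicator {0..1 / real r} t *\<^sub>R F t - ?G (lam r x / 2) t \<partial>lborel)"
    using set_borel_integral_eq_integral(2)[OF int_F] int_F half
    by (subst Bochner_Integration.integral_diff)
      (auto simp: set_integrable_def set_lebesgue_integral_def has_bochner_integral_iff)
  have "\<bar>integral {0..1 / real r} F - sqrt (2 * pi / lam r x) / 2\<bar> \<le> (\<integral>t. ?c * ?G (lam r x / 8) t \<partial>lborel)"
    unfolding diff
  proof (rule integral_abs_bound_integral)
    show "integrable lborel (\<lambda>t. indicator {0..1 / real r} t *\<^sub>R F t - ?G (lam r x / 2) t)"
      using int_F half by (intro Bochner_Integration.integrable_diff) (auto simp: set_integrable_def has_bochner_integral_iff)
    show "integrable lborel (\<lambda>t. ?c * ?G (lam r x / 8) t)"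
      using eighth by (auto simp: has_bochner_integral_iff)
    fix t
    show "\<bar>indicator {0..1 / real r} t *\<^sub>R F t - ?G (lam r x / 2) t\<bar> \<le> ?c * ?G (lam r x / 8) t"
    proof (cases "t \<le> 1 / real r")
      case True
      then show ?thesis using inner_gaussian_approx[of t] by (cases "0 \<le> t") (simp_all add: F_def)
    next
      case False
      moreover have "0 < 1 / real r" using r_pos by simp
      ultimately have "0 \<le> t" by linarith
      then show ?thesis using gaussian_tail_le[of t] False by simp
    qed
  qed
  also have "\<dots> = ?c * (sqrt (8 * pi / lam r x) / 2)"
    unfolding Bochner_Integration.integral_mult_right_zero has_bochner_integral_integral_eq[OF eighth] ..
  also have "\<dots> \<le> ?c * sqrt (8 * pi / lam r x)"
    using lam_pos by (intro mult_left_mono) auto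
  finally show ?thesis by (simp add: F_def)
qed

end

section \<open>The tail integral by parts\<close>

text \<open>With \<open>W = (\<Sum>j=1..r. (of_real x * cis t) ^ j)\<close>, the derivative of
  \<open>- damping + \<i> * phase\<close> is \<open>\<i> * (W - (\<Sum>j=1..r. x ^ j))\<close>; the
  derivatives of damping and phase are read off from its two parts.\<close>

lemma DERIV_damping:
  "(damping r x has_real_derivative Im (\<Sum>j=1..r. (of_real x * cis t) ^ j)) (at t)"
proof -
  have "((\<lambda>t. \<Sum>j=1..r. x ^ j * (1 - cos (real j * t)) / real j) has_real_derivative
      (\<Sum>j=1..r. x ^ j * (sin (real j * t) * real j) / real j)) (at t)"
    by (auto intro!: derivative_eq_intros sum.cong simp: mult.commute)
  also have "(\<Sum>j=1..r. x ^ j * (sin (real j * t) * real j) / real j) = Im (\<Sum>j=1..r. (of_real x * cis t) ^ j)"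
    unfolding Im_sum by (intro sum.cong) (auto simp: power_mult_distrib Complex.DeMoivre simp flip: of_real_power)
  finally show ?thesis by (simp add: damping_def [abs_def])
qed

lemma DERIV_phase:
  "(phase r x has_real_derivative Re (\<Sum>j=1..r. (of_real x * cis t) ^ j) - (\<Sum>j=1..r. x ^ j)) (at t)"
proof -
  have "((\<lambda>t. \<Sum>j=1..r. x ^ j * (sin (real j * t) - real j * t) / real j) has_real_derivative
      (\<Sum>j=1..r. x ^ j * (cos (real j * t) * real j - real j) / real j)) (at t)"
    by (auto intro!: derivative_eq_intros sum.cong simp: mult.commute)
  also have "(\<Sum>j=1..r. x ^ j * (cos (real j * t) * real j - real j) / real j)
      = Re (\<Sum>j=1..r. (of_real x * cis t) ^ j) - (\<Sum>j=1..r. x ^ j)"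
    unfolding Re_sum sum_subtractf[symmetric]
    by (intro sum.cong) (auto simp: power_mult_distrib Complex.DeMoivre diff_divide_distrib right_diff_distrib simp flip: of_real_power)
  finally show ?thesis by (simp add: phase_def [abs_def])
qed

text \<open>The antiderivative is explicit. Positivity of \<open>\<delta>\<close> makes the bound
  independent of \<open>b\<close>, where exponent -1 would give a logarithm.\<close>

lemma powr_tail_integral_le:
  fixes c \<delta> b :: real
  assumes c: "0 < c" and \<delta>: "0 < \<delta>" and b: "1 / c \<le> b"
  shows "(\<lambda>t. (c * t) powr (- \<delta> - 1)) integrable_on {1 / c..b}"
    and "integral {1 / c..b} (\<lambda>t. (c * t) powr (- \<delta> - 1)) \<le> 1 / (c * \<delta>)"
proof -
  let ?P = "\<lambda>t. - ((c * t) powr (- \<delta>)) / (c * \<delta>)"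
  have "((\<lambda>t. (c * t) powr (- \<delta> - 1)) has_integral (?P b - ?P (1 / c))) {1 / c..b}"
  proof (rule fundamental_theorem_of_calculus[OF b])
    fix t assume t: "t \<in> {1 / c..b}"
    have "0 < 1 / c" using c by simp
    moreover have "1 / c \<le> t" using t by simp
    ultimately have "0 < t" by linarith
    then have "0 < c * t" using c by simp
    then have "((\<lambda>t. (c * t) powr (- \<delta>)) has_real_derivative (- \<delta> * (c * t) powr (- \<delta> - 1)) * c) (at t)"
      by (intro DERIV_chain2[OF has_real_derivative_powr]) (auto intro!: derivative_eq_intros)
    from DERIV_cdivide[OF DERIV_minus[OF this], of "c * \<delta>"]
    have D: "(?P has_real_derivative - (- \<delta> * (c * t) powr (- \<delta> - 1) * c) / (c * \<delta>)) (at t)" .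
    have eq: "- (- \<delta> * y * c) / (c * \<delta>) = y" for y
      using c \<delta> by simp
    show "(?P has_vector_derivative (c * t) powr (- \<delta> - 1)) (at t within {1 / c..b})"
      using has_vector_derivative_at_within[OF D[unfolded eq has_real_derivative_iff_has_vector_derivative]] .
  qed
  moreover have "?P b - ?P (1 / c) \<le> 1 / (c * \<delta>)" using c \<delta> by simp
  ultimately show "(\<lambda>t. (c * t) powr (- \<delta> - 1)) integrable_on {1 / c..b}"
    "integral {1 / c..b} (\<lambda>t. (c * t) powr (- \<delta> - 1)) \<le> 1 / (c * \<delta>)"
    by (auto simp: integral_unique)
qed

context saddle_point
begin

text \<open>Integrating \<open>d/dt (exp (- damping) * sin phase)\<close> replaces the integrand by one that carries
  the factor \<open>(\<Sum>j. (x * cis t)^j) / n\<close>. Without this gain the absolute integral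
  would exceed the main term by a factor \<open>ln r\<close> when \<open>u\<close> is bounded.\<close>
lemma outer_integral:
  "\<bar>integral {1 / real r..pi} (\<lambda>t. exp (- damping r x t) * cos (phase r x t))\<bar>
    \<le> 256002 * u * exp (- sqrt (sqrt u) / 2560) / real r"
proof -
  define q where "q = exp (- sqrt (sqrt u) / 2560)"
  define E where "E = (\<lambda>t. exp (- damping r x t) * sin (phase r x t))"
  define F where "F = (\<lambda>t. exp (- damping r x t) * cos (phase r x t))"
  define W where "W = (\<lambda>t. \<Sum>j=1..r. (of_real x * cis t) ^ j :: complex)"
  define H where "H = (\<lambda>t. exp (- damping r x t) * (Re (W t) * cos (phase r x t) - Im (W t) * sin (phase r x t)))"
  let ?I = "{1 / real r..pi}"
  have r0: "0 < real r" using r_pos by simp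
  have "1 / real r \<le> 1" using r_pos by simp
  then have le: "1 / real r \<le> pi" using pi_gt3 by linarith
  have q: "0 < q" by (simp add: q_def)
  \<comment> \<open>By the saddle equation the phase contributes \<open>Re (W t) - n\<close> to the
    derivative. The part with \<open>n\<close> reproduces \<open>F\<close>, and \<open>H\<close>
    collects the rest.\<close>
  have dE: "(E has_real_derivative (H t - real n * F t)) (at t)" for t
    unfolding E_def H_def F_def W_def
    by (rule derivative_eq_intros DERIV_damping DERIV_phase refl)+ (use saddle_eq in \<open>simp add: algebra_simps\<close>)
  have cont_F: "continuous_on ?I F" unfolding F_def by (intro continuous_intros)
  have int_F: "F integrable_on ?I" by (rule integrable_continuous_real[OF cont_F])
  have int_dE: "((\<lambda>t. H t - real n * F t) has_integral (E pi - E (1 / real r))) ?I"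
    by (intro fundamental_theorem_of_calculus le)
      (simp add: has_field_derivative_at_within[OF dE] flip: has_real_derivative_iff_has_vector_derivative)
  have "((\<lambda>t. (H t - real n * F t) + real n * F t) has_integral
      (E pi - E (1 / real r)) + real n * integral ?I F) ?I"
    using int_F by (intro has_integral_add[OF int_dE] has_integral_mult_right integrable_integral)
  then have H_int: "(H has_integral (E pi - E (1 / real r)) + real n * integral ?I F) ?I" by simp
  have bound: "norm (H t) \<le> 20 * u\<^sup>2 * real r * q * (real r * t) powr (- (1/12800) - 1)" if t: "t \<in> ?I" for t
  proof -
    have "0 < 1 / real r" "1 / real r \<le> t" using t r0 by auto
    then have t0: "0 < t" by linarith
    have "\<bar>Re (W t) * cos (phase r x t) - Im (W t) * sin (phase r x t)\<bar> = \<bar>Re (W t * cis (phase r x t))\<bar>"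
      by simp
    also have "\<dots> \<le> norm (W t)" using abs_Re_le_cmod[of "W t * cis (phase r x t)"] by (simp add: norm_mult)
    also have "\<dots> \<le> 20 * x ^ r / t" unfolding W_def using t t0 x_ge_1 by (intro norm_geometric_cis_sum_le) auto
    also have "\<dots> \<le> 20 * u\<^sup>2 / t" using power_r_le t0 by (intro divide_right_mono) auto
    finally have "norm (H t) \<le> exp (- damping r x t) * (20 * u\<^sup>2 / t)"
      unfolding H_def real_norm_def abs_mult by (intro mult_mono) auto
    also have "\<dots> \<le> (q * (real r * t) powr (- 1 / 12800)) * (20 * u\<^sup>2 / t)"
      using exp_damping_le[of t] t t0 unfolding q_def by (intro mult_right_mono) auto
    also have "\<dots> = 20 * u\<^sup>2 * real r * q * ((real r * t) powr (- (1 / 12800)) / (real r * t))"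
      using r0 t0 by simp
    also have "(real r * t) powr (- (1 / 12800)) / (real r * t) = (real r * t) powr (- (1/12800) - 1)"
      using r0 t0 by (subst powr_diff) simp
    finally show ?thesis .
  qed
  have "norm (integral ?I H) \<le> integral ?I (\<lambda>t. 20 * u\<^sup>2 * real r * q * (real r * t) powr (- (1/12800) - 1))"
    using H_int bound powr_tail_integral_le(1)[OF r0 _ le, of "1/12800"]
    by (intro integral_norm_bound_integral integrable_on_mult_right) (auto simp: has_integral_iff)
  also have "\<dots> = 20 * u\<^sup>2 * real r * q * integral ?I (\<lambda>t. (real r * t) powr (- (1/12800) - 1))"
    by (rule integral_mult_right)
  also have "\<dots> \<le> 20 * u\<^sup>2 * real r * q * (1 / (real r * (1/12800)))"
    using powr_tail_integral_le(2)[OF r0 _ le, of "1/12800"] r0 q by (intro mult_left_mono) auto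
  \<comment> \<open>Here 256000 = 20 * 12800; the two boundary terms later raise it to 256002, using
    \<open>u \<ge> 1\<close>.\<close>
  also have "\<dots> = 256000 * u\<^sup>2 * q" using r0 by simp
  finally have H_le: "\<bar>integral ?I H\<bar> \<le> 256000 * u\<^sup>2 * q" by simp
  have E_le: "\<bar>E t\<bar> \<le> q" if t: "t \<in> ?I" for t
  proof -
    have "1 \<le> real r * t" using t r0 by (simp add: field_simps)
    then have "(real r * t) powr (- 1 / 12800) \<le> (real r * t) powr 0" by (intro powr_mono) auto
    also have "\<dots> = 1" using \<open>1 \<le> real r * t\<close> r0 by (cases "t = 0") auto
    finally have p1: "(real r * t) powr (- 1 / 12800) \<le> 1" .
    have "\<bar>E t\<bar> \<le> exp (- damping r x t) * 1"
      unfolding E_def abs_mult by (intro mult_mono) auto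
    also have "\<dots> \<le> exp (- sqrt (sqrt u) / 2560) * (real r * t) powr (- 1 / 12800)"
      using exp_damping_le[of t] t by simp
    also have "\<dots> \<le> exp (- sqrt (sqrt u) / 2560) * 1" using p1 by (intro mult_left_mono) auto
    also have "\<dots> \<le> q"
      unfolding q_def using u_ge_1 by simp
    finally show ?thesis .
  qed
  have "real n * integral ?I F = integral ?I H - E pi + E (1 / real r)"
    using H_int by (simp add: has_integral_iff)
  moreover have "\<bar>E pi\<bar> \<le> q" "\<bar>E (1 / real r)\<bar> \<le> q" using E_le le by auto
  ultimately have "\<bar>real n * integral ?I F\<bar> \<le> 256000 * u\<^sup>2 * q + q + q"
    using H_le by linarith
  also have "\<dots> \<le> 256002 * u\<^sup>2 * q"
  proof -
    have "1 * q \<le> u\<^sup>2 * q" using one_le_power[OF u_ge_1, of 2] q by (intro mult_right_mono) auto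
    then show ?thesis by linarith
  qed
  finally have "u * real r * \<bar>integral ?I F\<bar> \<le> 256002 * u\<^sup>2 * q"
    using u_ge_1 unfolding n_eq abs_mult by simp
  then have "\<bar>integral ?I F\<bar> \<le> 256002 * u * q / real r"
    using u_ge_1 r0 by (simp add: field_simps power2_eq_square)
  then show ?thesis by (simp add: F_def q_def)
qed

end

section \<open>Generating function and Fourier inversion\<close>

text \<open>The exponential series converges for every complex \<open>w\<close>, so points of
  modulus \<open>x \<ge> 1\<close> are admissible.\<close>

lemma poisson_pmf_generating_function:
  fixes w :: complex
  assumes c: "0 < c"
  shows "has_bochner_integral (measure_pmf (poisson_pmf c)) (\<lambda>k. w ^ k) (exp (of_real c * (w - 1)))"
proof -
  let ?f = "\<lambda>k. pmf (poisson_pmf c) k *\<^sub>R w ^ k"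
  have f: "?f k = of_real (exp (- c)) * ((of_real c * w) ^ k /\<^sub>R fact k)" for k
    using c by (simp add: power_mult_distrib scaleR_conv_of_real field_simps)
  have "summable (\<lambda>k. norm (?f k))"
    unfolding f norm_mult by (intro summable_mult summable_norm_exp)
  then have int: "integrable (count_space UNIV) ?f"
    by (simp add: integrable_count_space_nat_iff)
  have "?f sums (of_real (exp (- c)) * exp (of_real c * w))"
    unfolding f by (intro sums_mult exp_converges)
  also have "of_real (exp (- c)) * exp (of_real c * w) = exp (of_real c * (w - 1))"
    by (simp add: exp_of_real[symmetric] right_diff_distrib flip: exp_add)
  finally have "integral\<^sup>L (count_space UNIV) ?f = exp (of_real c * (w - 1))"
    using integral_count_space_nat[OF int] by (simp add: sums_iff)
  then show ?thesis
    using int unfolding measure_pmf_eq_density has_bochner_integral_iff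
    by (simp add: integrable_density integral_density)
qed

lemma measurable_ell:
  assumes "indep_poisson_harmonic M Z"
  shows "ell r Z \<in> measurable M (count_space UNIV)"
proof -
  interpret prob_space M using assms by (simp add: indep_poisson_harmonic_def)
  have "Z j \<in> measurable M (count_space UNIV)" if "j \<in> {1..r}" for j
    using assms that by (simp add: indep_poisson_harmonic_def indep_vars_def)
  then have "(\<lambda>\<omega>. j * Z j \<omega>) \<in> measurable M (count_space UNIV)" if "j \<in> {1..r}" for j
    using measurable_compose[of "Z j" M "count_space UNIV" "\<lambda>k. j * k" "count_space UNIV"] that by simp
  then have "(\<lambda>\<omega>. \<Sum>j=1..r. j * Z j \<omega>) \<in> measurable M (count_space UNIV)"
    by (rule measurable_sum_nat)
  then show ?thesis unfolding ell_def [abs_def] .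
qed

text \<open>\<open>w ^ ell r Z \<omega>\<close> is the product of the
  \<open>(w ^ j) ^ Z j \<omega>\<close>, so independence reduces the claim to the Poisson case with
  mean \<open>1 / j\<close> at the point \<open>w ^ j\<close>.\<close>

lemma ell_generating_function:
  fixes w :: complex
  assumes "indep_poisson_harmonic M Z"
  shows "has_bochner_integral M (\<lambda>\<omega>. w ^ ell r Z \<omega>) (exp (\<Sum>j=1..r. (w ^ j - 1) / of_nat j))"
proof -
  interpret prob_space M using assms by (simp add: indep_poisson_harmonic_def)
  have indep: "indep_vars (\<lambda>_. count_space UNIV) Z {1..}"
    and distr: "distr M (count_space UNIV) (Z j) = measure_pmf (poisson_pmf (1 / real j))" if "1 \<le> j" for j
    using assms that by (simp_all add: indep_poisson_harmonic_def)
  have Z_meas: "Z j \<in> measurable M (count_space UNIV)" if "1 \<le> j" for j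
    using indep[of 1] that by (simp add: indep_vars_def)
  let ?X = "\<lambda>j \<omega>. (w ^ j) ^ Z j \<omega>"
  have X: "has_bochner_integral M (?X j) (exp ((w ^ j - 1) / of_nat j))" if j: "1 \<le> j" for j
  proof -
    have "has_bochner_integral (distr M (count_space UNIV) (Z j)) (\<lambda>k. (w ^ j) ^ k)
        (exp (of_real (1 / real j) * (w ^ j - 1)))"
      unfolding distr[OF j] using j by (intro poisson_pmf_generating_function) simp
    then show ?thesis
      using Z_meas[OF j] by (simp add: has_bochner_integral_iff integrable_distr_eq integral_distr)
  qed
  have "indep_vars (\<lambda>_. borel) ?X {1..r}"
    using indep_vars_subset[OF indep[of 1], of "{1..r}"]
    by (intro indep_vars_compose2[where M' = "\<lambda>_. count_space UNIV" and Y = "\<lambda>j k. (w ^ j) ^ k"]) auto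
  then have "has_bochner_integral M (\<lambda>\<omega>. \<Prod>j=1..r. ?X j \<omega>) (\<Prod>j=1..r. exp ((w ^ j - 1) / of_nat j))"
    using X indep_vars_lebesgue_integral[of "{1..r}" ?X] indep_vars_integrable[of "{1..r}" ?X]
    by (simp add: has_bochner_integral_iff)
  then show ?thesis
    by (simp add: ell_def power_sum power_mult exp_sum)
qed

lemma integral_cos_int:
  "integral {0..pi} (\<lambda>t. cos ((real k - real n) * t)) = (if k = n then pi else 0)"
proof (cases "k = n")
  case False
  define m where "m = real k - real n"
  have m: "m \<noteq> 0" using False by (simp add: m_def)
  have "m = of_int (int k - int n)" by (simp add: m_def)
  then have sin0: "sin (m * pi) = 0" using sin_npi_int[of "int k - int n"] by (simp add: mult.commute)
  have "((\<lambda>t. cos (m * t)) has_integral (sin (m * pi) / m - sin (m * 0) / m)) {0..pi}"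
  proof (rule fundamental_theorem_of_calculus)
    fix t
    have "((\<lambda>t. sin (m * t) / m) has_real_derivative cos (m * t)) (at t within {0..pi})"
      using m by (auto intro!: derivative_eq_intros)
    then show "((\<lambda>t. sin (m * t) / m) has_vector_derivative cos (m * t)) (at t within {0..pi})"
      by (simp add: has_real_derivative_iff_has_vector_derivative)
  qed simp
  then show ?thesis using sin0 False by (simp add: m_def integral_unique)
qed simp

text \<open>The real part of the exponent is its value at \<open>t = 0\<close> minus the damping. In
  the imaginary part the linear term removed by the centring of \<open>phase\<close>
  reappears.\<close>

lemma exp_generating_function_polar:
  "exp (\<Sum>j=1..r. ((of_real x * cis t) ^ j - 1) / of_nat j) =
    of_real (exp (\<Sum>j=1..r. (x ^ j - 1) / real j) * exp (- damping r x t)) *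
    cis (phase r x t + t * (\<Sum>j=1..r. x ^ j))"
proof -
  let ?S = "\<Sum>j=1..r. ((of_real x * cis t) ^ j - 1) / of_nat j"
  have w: "(of_real x * cis t) ^ j = of_real (x ^ j) * cis (real j * t)" for j
    by (simp add: power_mult_distrib Complex.DeMoivre)
  have "Re ?S = (\<Sum>j=1..r. (x ^ j - 1) / real j) - damping r x t"
    unfolding Re_sum damping_def sum_subtractf[symmetric] w
    by (intro sum.cong refl) (simp add: Re_divide_of_nat diff_divide_distrib[symmetric] algebra_simps)
  moreover have "Im ?S = phase r x t + t * (\<Sum>j=1..r. x ^ j)"
    unfolding Im_sum phase_def sum_distrib_left sum.distrib[symmetric] w
    by (intro sum.cong refl) (simp add: Im_divide_of_nat field_simps)
  ultimately show ?thesis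
    by (simp add: exp_eq_polar exp_diff exp_minus divide_inverse)
qed

context saddle_point
begin

text \<open>Integrate \<open>x ^ ell * cos ((ell - n) * t)\<close> over \<open>M\<close> and
  \<open>[0, pi]\<close> in both orders. Over \<open>t\<close> first, orthogonality leaves
  \<open>pi * x ^ n\<close> on the event \<open>ell = n\<close>; over \<open>M\<close> first, the
  generating function gives the damped cosine.\<close>

lemma prob_ell_eq_integral:
  assumes MZ: "indep_poisson_harmonic M Z"
  shows "measure M {\<omega> \<in> space M. ell r Z \<omega> = n} =
    Qfun n r x * integral {0..pi} (\<lambda>t. exp (- damping r x t) * cos (phase r x t)) / pi"
proof -
  interpret prob_space M using MZ by (simp add: indep_poisson_harmonic_def)
  interpret P: pair_sigma_finite M lborel ..
  have ell [measurable]: "ell r Z \<in> measurable M (count_space UNIV)" by (rule measurable_ell[OF MZ])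
  have pow [measurable]: "(\<lambda>\<omega>. x ^ ell r Z \<omega>) \<in> borel_measurable M"
    by (rule measurable_compose[OF ell]) simp
  have diff [measurable]: "(\<lambda>\<omega>. real (ell r Z \<omega>) - real n) \<in> borel_measurable M"
    by (rule measurable_compose[OF ell]) simp
  define F where "F = (\<lambda>t. exp (- damping r x t) * cos (phase r x t))"
  define K where "K = exp (\<Sum>j=1..r. (x ^ j - 1) / real j)"
  define f where "f = (\<lambda>\<omega> t. indicator {0..pi} t *\<^sub>R (x ^ ell r Z \<omega> * cos ((real (ell r Z \<omega>) - real n) * t)))"
  have gf: "has_bochner_integral M (\<lambda>\<omega>. w ^ ell r Z \<omega>) (exp (\<Sum>j=1..r. (w ^ j - 1) / of_nat j))" for w :: complex
    by (rule ell_generating_function[OF MZ])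
  have int_pow: "integrable M (\<lambda>\<omega>. x ^ ell r Z \<omega>)"
    using integrable_Re[of M "\<lambda>\<omega>. of_real x ^ ell r Z \<omega>"] gf[of "of_real x"]
    by (simp add: has_bochner_integral_iff flip: of_real_power)
  have sect: "set_integrable lborel {0..pi} (\<lambda>t. x ^ k * cos ((real k - real n) * t))" for k
    by (intro borel_integrable_atLeastAtMost' continuous_intros)
  have f_meas: "(\<lambda>(\<omega>, t). f \<omega> t) \<in> borel_measurable (M \<Otimes>\<^sub>M lborel)"
    unfolding f_def by measurable
  have int_f: "integrable (M \<Otimes>\<^sub>M lborel) (\<lambda>(\<omega>, t). f \<omega> t)"
  proof (rule P.Fubini_integrable[OF f_meas])
    show "AE \<omega> in M. integrable lborel (\<lambda>t. case (\<omega>, t) of (\<omega>, t) \<Rightarrow> f \<omega> t)"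
      using sect by (simp add: f_def set_integrable_def)
    show "integrable M (\<lambda>\<omega>. \<integral>t. norm (case (\<omega>, t) of (\<omega>, t) \<Rightarrow> f \<omega> t) \<partial>lborel)"
    proof (rule Bochner_Integration.integrable_bound)
      \<comment> \<open>The dominating function is integrable by the generating function at the real
        point \<open>x\<close>.\<close>
      show "integrable M (\<lambda>\<omega>. pi * x ^ ell r Z \<omega>)" using int_pow by simp
      show "(\<lambda>\<omega>. \<integral>t. norm (case (\<omega>, t) of (\<omega>, t) \<Rightarrow> f \<omega> t) \<partial>lborel) \<in> borel_measurable M"
        using f_meas by measurable
      have "(\<integral>t. norm (f \<omega> t) \<partial>lborel) \<le> (\<integral>t. indicator {0..pi} t *\<^sub>R x ^ ell r Z \<omega> \<partial>lborel)" for \<omega>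
      proof (rule integral_mono)
        show "integrable lborel (\<lambda>t. norm (f \<omega> t))"
          using sect by (intro integrable_norm) (simp add: f_def set_integrable_def)
        show "integrable lborel (\<lambda>t. indicator {0..pi} t *\<^sub>R x ^ ell r Z \<omega>)"
          by (simp add: integrable_real_indicator)
        fix t
        show "norm (f \<omega> t) \<le> indicator {0..pi} t *\<^sub>R x ^ ell r Z \<omega>"
          using x_pos by (auto simp: f_def abs_mult indicator_def intro!: mult_left_le)
      qed
      then show "AE \<omega> in M. norm (\<integral>t. norm (case (\<omega>, t) of (\<omega>, t) \<Rightarrow> f \<omega> t) \<partial>lborel) \<le> norm (pi * x ^ ell r Z \<omega>)"
        using x_pos by (simp add: abs_mult)
    qed
  qed
  have over_M: "(\<integral>\<omega>. f \<omega> t \<partial>M) = indicator {0..pi} t *\<^sub>R (K * F t)" for t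
  proof -
    let ?w = "of_real x * cis t"
    have eq: "x ^ k * cos ((real k - real n) * t) = Re (cis (- (real n * t)) * ?w ^ k)" for k
      by (simp add: power_mult_distrib Complex.DeMoivre cos_diff left_diff_distrib algebra_simps flip: of_real_power)
    \<comment> \<open>The saddle equation makes the linear phase equal to \<open>t * n\<close>,
      which the inversion factor removes.\<close>
    have cancel: "cis (- (real n * t)) * (of_real c * cis (b + t * real n)) = of_real c * cis b" for b c
      by (subst mult.left_commute) (simp add: cis_mult mult.commute[of t])
    have "has_bochner_integral M (\<lambda>\<omega>. Re (cis (- (real n * t)) * ?w ^ ell r Z \<omega>))
        (Re (cis (- (real n * t)) * exp (\<Sum>j=1..r. (?w ^ j - 1) / of_nat j)))"
      by (intro has_bochner_integral_Re has_bochner_integral_mult_right gf)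
    moreover have "Re (cis (- (real n * t)) * exp (\<Sum>j=1..r. (?w ^ j - 1) / of_nat j)) = K * F t"
      unfolding exp_generating_function_polar saddle_eq cancel by (simp add: K_def F_def)
    ultimately have "(\<integral>\<omega>. x ^ ell r Z \<omega> * cos ((real (ell r Z \<omega>) - real n) * t) \<partial>M) = K * F t"
      unfolding eq by (simp add: has_bochner_integral_iff)
    then show ?thesis by (simp add: f_def)
  qed
  have over_t: "(\<integral>t. f \<omega> t \<partial>lborel) = (x ^ n * pi) * indicator {\<omega>. ell r Z \<omega> = n} \<omega>" for \<omega>
  proof -
    have "(\<integral>t. f \<omega> t \<partial>lborel) = integral {0..pi} (\<lambda>t. x ^ ell r Z \<omega> * cos ((real (ell r Z \<omega>) - real n) * t))"
      unfolding f_def using set_borel_integral_eq_integral(2)[OF sect] by (simp only: set_lebesgue_integral_def)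
    also have "\<dots> = x ^ ell r Z \<omega> * (if ell r Z \<omega> = n then pi else 0)"
      by (simp only: integral_mult_right integral_cos_int)
    finally show ?thesis by simp
  qed
  have int_F: "set_integrable lborel {0..pi} F"
    unfolding F_def by (intro borel_integrable_atLeastAtMost' continuous_intros)
  have "K * integral {0..pi} F = (\<integral>t. indicator {0..pi} t *\<^sub>R (K * F t) \<partial>lborel)"
    using set_borel_integral_eq_integral(2)[OF int_F]
    by (simp add: set_lebesgue_integral_def mult.left_commute[of _ K] del: integral_indicator)
  also have "\<dots> = (\<integral>t. (\<integral>\<omega>. f \<omega> t \<partial>M) \<partial>lborel)"
    by (simp only: over_M)
  also have "\<dots> = (\<integral>\<omega>. (\<integral>t. f \<omega> t \<partial>lborel) \<partial>M)"
    by (rule P.Fubini_integral[OF int_f])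
  also have "\<dots> = x ^ n * pi * measure M {\<omega> \<in> space M. ell r Z \<omega> = n}"
    by (simp add: over_t Int_def conj_commute)
  finally show ?thesis
    using x_pos by (simp add: Qfun_def K_def F_def field_simps)
qed

end

section \<open>Assembly of the relative error\<close>

context saddle_point
begin

text \<open>Write \<open>u = s ^ 4\<close>, so that
  \<open>sqrt (lam r x) \<le> r * s\<^sup>2\<close> and \<open>r / n = 1 / s ^ 4\<close>. The tail
  bound exceeds the target scale by \<open>s ^ (4 + 4 + 2)\<close>, and the exponential absorbs
  \<open>s ^ 10\<close> at the price of (2560 * 10)^10.\<close>

lemma outer_integral_powers:
  "\<bar>integral {1 / real r..pi} (\<lambda>t. exp (- damping r x t) * cos (phase r x t))\<bar>
    \<le> 256002 * 25600 ^ 10 * (real r / real n) / sqrt (lam r x)"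
proof -
  define s where "s = sqrt (sqrt u)"
  have s: "0 < s" using u_ge_1 by (simp add: s_def)
  have s2: "s\<^sup>2 = sqrt u" using u_ge_1 by (simp add: s_def)
  have "s ^ 4 = (s\<^sup>2)\<^sup>2" by (simp flip: power_mult)
  then have s4: "u = s ^ 4" using u_ge_1 by (simp add: s2)
  have r0: "0 < real r" using r_pos by simp
  have "lam r x \<le> (real r * s\<^sup>2)\<^sup>2"
    using lam_le u_ge_1 by (simp add: n_eq s2 power_mult_distrib) (simp add: power2_eq_square mult_ac)
  then have "sqrt (lam r x) \<le> real r * s\<^sup>2" using s by (simp add: real_le_lsqrt)
  then have lam: "1 / (real r * s\<^sup>2) \<le> 1 / sqrt (lam r x)"
    using lam_pos s r0 by (intro divide_left_mono mult_pos_pos) auto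
  have "256002 * u * exp (- sqrt (sqrt u) / 2560) / real r
      = 256002 * (s ^ 10 * exp (- s / 2560)) * (1 / s ^ 4) * (1 / (real r * s\<^sup>2))"
    unfolding s_def[symmetric] unfolding s4 using s r0 by (simp add: field_simps flip: power_add)
  also have "\<dots> \<le> 256002 * 25600 ^ 10 * (1 / s ^ 4) * (1 / sqrt (lam r x))"
    using power_times_exp_le[of s 2560 10] s r0 lam by (intro mult_mono) auto
  also have "1 / s ^ 4 = real r / real n" using r0 by (simp add: n_eq s4)
  finally show ?thesis using outer_integral by simp
qed

lemma oscillatory_integral_approx:
  "\<bar>integral {0..pi} (\<lambda>t. exp (- damping r x t) * cos (phase r x t)) - sqrt (2 * pi / lam r x) / 2\<bar>
    \<le> (4096 + 256002 * 25600 ^ 10) * (real r / real n) / sqrt (lam r x)"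
proof -
  let ?F = "\<lambda>t. exp (- damping r x t) * cos (phase r x t)"
  have r0: "0 < real r" and n0: "0 < real n" using r_pos r_le_n by simp_all
  have "1 / real r \<le> 1" using r_pos by simp
  then have "1 / real r \<le> pi" using pi_gt3 by linarith
  then have split: "integral {0..pi} ?F = integral {0..1 / real r} ?F + integral {1 / real r..pi} ?F"
    using r0 by (intro Henstock_Kurzweil_Integration.integral_combine[symmetric] integrable_continuous_real continuous_intros) auto
  \<comment> \<open>The lower bound on \<open>lam\<close> gives the factor 2 and
    \<open>sqrt (8 * pi) \<le> 8\<close>; hence 4096 = 256 * 2 * 8.\<close>
  have "256 * ((real r)\<^sup>2 / lam r x) * sqrt (8 * pi / lam r x)
      \<le> 256 * (2 * (real r / real n)) * (8 / sqrt (lam r x))"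
  proof (intro mult_mono mult_left_mono)
    have "(real r)\<^sup>2 / lam r x \<le> (real r)\<^sup>2 / (real r * real n / 2)"
      using lam_ge lam_pos r0 n0 by (intro divide_left_mono) auto
    also have "\<dots> = 2 * (real r / real n)" using r0 by (simp add: power2_eq_square)
    finally show "(real r)\<^sup>2 / lam r x \<le> 2 * (real r / real n)" .
    have "sqrt (8 * pi) \<le> sqrt (8\<^sup>2)" using pi_less_4 by (intro real_sqrt_le_mono) simp
    then have "sqrt (8 * pi) / sqrt (lam r x) \<le> 8 / sqrt (lam r x)"
      using lam_pos by (intro divide_right_mono) auto
    then show "sqrt (8 * pi / lam r x) \<le> 8 / sqrt (lam r x)" by (simp add: real_sqrt_divide)
  qed (use lam_pos in auto)
  also have "\<dots> = 4096 * (real r / real n) / sqrt (lam r x)" by simp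
  finally show ?thesis
    using inner_integral outer_integral_powers unfolding split distrib_right add_divide_distrib
    by linarith
qed

lemma relative_error:
  assumes MZ: "indep_poisson_harmonic M Z"
  shows "\<exists>\<epsilon>. measure M {\<omega> \<in> space M. ell r Z \<omega> = n} = Qfun n r x / sqrt (2 * pi * lam r x) * (1 + \<epsilon>) \<and>
    \<bar>\<epsilon>\<bar> \<le> 3 * (4096 + 256002 * 25600 ^ 10) * real r / real n"
proof -
  define I where "I = integral {0..pi} (\<lambda>t. exp (- damping r x t) * cos (phase r x t))"
  define C :: real where "C = 4096 + 256002 * 25600 ^ 10"
  define \<sigma> where "\<sigma> = sqrt (lam r x)"
  define \<rho> where "\<rho> = sqrt (2 * pi)"
  have \<sigma>: "0 < \<sigma>" and \<rho>: "0 < \<rho>" using lam_pos by (simp_all add: \<sigma>_def \<rho>_def)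
  have \<rho>2: "\<rho> * \<rho> = 2 * pi" by (simp add: \<rho>_def)
  have C: "0 < C" by (simp add: C_def)
  have sqrt_mult: "sqrt (2 * pi * lam r x) = \<rho> * \<sigma>" by (simp add: \<rho>_def \<sigma>_def real_sqrt_mult)
  have "sqrt (2 * pi) \<le> sqrt (3\<^sup>2)" using pi_less_4 by (intro real_sqrt_le_mono) simp
  then have \<rho>_pi: "\<rho> / pi \<le> 3" using pi_gt3 by (simp add: \<rho>_def field_simps)
  \<comment> \<open>The main term of \<open>I\<close> is \<open>\<rho> / (2 * \<sigma>)\<close>. Its
    reciprocal is \<open>\<rho> * \<sigma> / pi\<close> because
    \<open>\<rho> * \<rho> = 2 * pi\<close>, so \<open>\<epsilon>\<close> is the relative error of
    \<open>I\<close>.\<close>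
  define \<epsilon> where "\<epsilon> = \<rho> * \<sigma> / pi * (I - \<rho> / \<sigma> / 2)"
  have eps: "1 + \<epsilon> = \<rho> * \<sigma> * I / pi"
    using \<sigma> \<rho>2 by (simp add: \<epsilon>_def field_simps)
  have "measure M {\<omega> \<in> space M. ell r Z \<omega> = n} = Qfun n r x / sqrt (2 * pi * lam r x) * (1 + \<epsilon>)"
    unfolding prob_ell_eq_integral[OF MZ] eps sqrt_mult using \<sigma> \<rho> by (simp add: I_def)
  moreover have "\<bar>\<epsilon>\<bar> \<le> 3 * C * real r / real n"
  proof -
    have "sqrt (2 * pi / lam r x) = \<rho> / \<sigma>" by (simp add: \<rho>_def \<sigma>_def real_sqrt_divide)
    then have "\<bar>I - \<rho> / \<sigma> / 2\<bar> \<le> C * (real r / real n) / \<sigma>"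
      using oscillatory_integral_approx by (simp only: I_def C_def \<sigma>_def)
    then have "\<rho> * \<sigma> / pi * \<bar>I - \<rho> / \<sigma> / 2\<bar> \<le> \<rho> * \<sigma> / pi * (C * (real r / real n) / \<sigma>)"
      using \<sigma> \<rho> by (intro mult_left_mono) auto
    also have "\<dots> = \<rho> / pi * (C * (real r / real n))" using \<sigma> by simp
    also have "\<dots> \<le> 3 * (C * (real r / real n))"
      using \<rho>_pi C by (intro mult_right_mono) auto
    finally show ?thesis using \<sigma> \<rho> by (simp add: \<epsilon>_def abs_mult)
  qed
  ultimately show ?thesis unfolding C_def by blast
qed

end

theorem corollary2:
  shows "\<exists>C>0. \<forall>(M :: 'a measure) (Z :: nat \<Rightarrow> 'a \<Rightarrow> nat). indep_poisson_harmonic M Z \<longrightarrow>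
    (\<forall>n r :: nat. 1 \<le> r \<and> r \<le> n \<longrightarrow>
      (let x = saddle r (real n / real r) in
        \<exists>\<epsilon> :: real.
          measure M {\<omega> \<in> space M. ell r Z \<omega> = n} =
            Qfun n r x / sqrt (2 * pi * lam r x) * (1 + \<epsilon>) \<and>
          \<bar>\<epsilon>\<bar> \<le> C * real r / real n))"
proof (intro exI[of _ "3 * (4096 + 256002 * 25600 ^ 10) :: real"] conjI allI impI)
  fix M :: "'a measure" and Z :: "nat \<Rightarrow> 'a \<Rightarrow> nat" and n r :: nat
  assume MZ: "indep_poisson_harmonic M Z" and nr: "1 \<le> r \<and> r \<le> n"
  let ?x = "saddle r (real n / real r)"
  have "1 \<le> real n / real r" using nr by simp
  then have "\<exists>!x::real. 0 < x \<and> (\<Sum>j=1..r. x ^ j) = real n / real r * real r"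
    using nr by (intro saddle_unique) auto
  from theI'[OF this] have x: "0 < ?x \<and> (\<Sum>j=1..r. ?x ^ j) = real n / real r * real r"
    unfolding saddle_def .
  interpret saddle_point n r ?x
    using x nr by unfold_locales auto
  show "let x = ?x in \<exists>\<epsilon>. measure M {\<omega> \<in> space M. ell r Z \<omega> = n} =
      Qfun n r x / sqrt (2 * pi * lam r x) * (1 + \<epsilon>) \<and>
      \<bar>\<epsilon>\<bar> \<le> 3 * (4096 + 256002 * 25600 ^ 10) * real r / real n"
    unfolding Let_def by (rule relative_error[OF MZ])
qed simp

end
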